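(* Let $a_1,a_2,\dots$ be independent standard exponential random variables (so $\mathbf{P}(a_n\ge t)=e^{-t}$ for all $n\ge 1$, $t\ge 0$), let $a_{(i,j)}$ be the Gilbreath array they generate, and let $c_i:=\mathbf{E}\,a_{(i,j)}$ for $i\ge 0$ (this is finite and independent of $j\ge 1$). Then $$\sum_{i=0}^n c_i\ge \log(n+e)$$ for every integer $n\ge 0$.
   Context: The Gilbreath array generated by an infinite sequence of real numbers $a_1,a_2,\dots$ is the array $a_{(i,j)}$, $i\ge 0$, $j\ge 1$, defined by $a_{(0,j)}=a_j$ and $a_{(i+1,j)}=|a_{(i,j)}-a_{(i,j+1)}|$. Here $\log$ is the natural logarithm and $e$ its base. *)

theory Defs
  imports "HOL-Probability.Probability"
begin

text \<open>Columns are numbered from 1 as in the paper; the entry \<open>a 0\<close> and the column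
  \<open>j = 0\<close> are junk, and no entry with \<open>j \<ge> 1\<close> depends on \<open>a 0\<close>.\<close>

primrec gilbreath :: "(nat \<Rightarrow> real) \<Rightarrow> nat \<Rightarrow> nat \<Rightarrow> real" where
  "gilbreath a 0 j = a j"
| "gilbreath a (Suc i) j = \<bar>gilbreath a i j - gilbreath a i (j + 1)\<bar>"

end

theory Submission
  imports Defs
begin

text \<open>
  Write \<open>S n\<close> for the sum of the expectations \<open>c i\<close> over \<open>i \<le> n\<close>. The logarithm comes from the
  recursive inequality \<open>c (n + 1) \<ge> exp (- S n)\<close>: it gives
  \<open>exp (S (n + 1)) \<ge> exp (S n) * exp (exp (- S n)) \<ge> exp (S n) * (1 + exp (- S n)) = exp (S n) + 1\<close>,
  so \<open>exp (S n)\<close> gains at least \<open>1\<close> at each step and starts at \<open>exp 1\<close>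
  (lemma \<open>ln_add_exp_1_le_of_increment\<close>).

  For the recursive inequality, view the entries in column \<open>1\<close> as obtained from
  \<open>a 1\<close> by absorbing, one after the other, the entries of column \<open>2\<close>. Each step replaces the current
  value \<open>d\<close> by \<open>\<bar>d - b\<bar> \<ge> d - b\<close>, so the entry in row \<open>n + 1\<close> is at least the positive part of
  \<open>a 1 - B\<close>, where \<open>B\<close> is the sum of the entries of column \<open>2\<close> in rows \<open>0\<close> to \<open>n\<close>. Now \<open>B\<close>
  depends only on \<open>a 2, a 3, \<dots>\<close> and is independent of \<open>a 1\<close>, and its mean is \<open>S n\<close> because
  the law of an entry does not depend on its column (lemma \<open>expectation_gilbreath_iid\<close>). The
  positive part is convex in \<open>B\<close>, so replacing \<open>B\<close> by its mean only lowers the expectation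
  (lemma \<open>expectation_max_zero_diff_ge\<close>), and the exponential variable \<open>a 1\<close> exceeds the level
  \<open>S n\<close> by \<open>exp (- S n)\<close> on average (lemma \<open>expectation_excess_exponential\<close>).
\<close>

text \<open>An entry in column \<open>j\<close> looks only to its right. This makes the junk value \<open>a 0\<close> harmless and
  makes column \<open>2\<close> independent of \<open>a 1\<close>.\<close>

lemma gilbreath_cong_tail:
  assumes "\<And>k. k \<ge> j \<Longrightarrow> a k = b k"
  shows "gilbreath a i j = gilbreath b i j"
  using assms
proof (induction i arbitrary: j)
  case (Suc i)
  have "gilbreath a i j = gilbreath b i j" "gilbreath a i (j + 1) = gilbreath b i (j + 1)"
    using Suc.prems by (auto intro!: Suc.IH)
  then show ?case by simp
qed simp

lemma gilbreath_shift: "gilbreath (\<lambda>k. a (k + d)) i j = gilbreath a i (j + d)"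
  by (induction i arbitrary: j) simp_all

lemma measurable_gilbreath:
  assumes "{j..} \<subseteq> I"
  shows "(\<lambda>x. gilbreath x i j) \<in> borel_measurable (PiM I (\<lambda>_. borel))"
  using assms
proof (induction i arbitrary: j)
  case 0
  then show ?case by auto
next
  case (Suc i)
  have "{j + 1..} \<subseteq> I" using Suc.prems by auto
  note [measurable] = Suc.IH[OF Suc.prems] Suc.IH[OF this]
  show ?case unfolding gilbreath.simps by measurable
qed

lemma integrable_gilbreath:
  assumes "\<And>k. k \<ge> j \<Longrightarrow> integrable M (a k)"
  shows "integrable M (\<lambda>\<omega>. gilbreath (\<lambda>k. a k \<omega>) i j)"
  using assms by (induction i arbitrary: j) auto

lemma gilbreath_nonneg:
  assumes "0 < i"
  shows "0 \<le> gilbreath a i j"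
  using assms by (cases i) auto

text \<open>Dropping the absolute value in each step down column \<open>j\<close> costs only an inequality, and the
  differences then telescope.\<close>

lemma gilbreath_ge_first_minus_next_column:
  "a j - (\<Sum>i<n. gilbreath a i (j + 1)) \<le> gilbreath a n j"
  by (induction n) (auto simp: abs_if)

text \<open>The right-hand side mentions only the common law \<open>D\<close>, so the expectation is the same
  in every column. The reason is that the law of the whole sequence is an infinite product of
  copies of \<open>D\<close>, and such a product is invariant under the shift \<open>k \<mapsto> k + (j - 1)\<close> that moves
  column \<open>j\<close> to column \<open>1\<close>.\<close>

lemma (in prob_space) expectation_gilbreath_iid:
  assumes "indep_vars (\<lambda>_. borel) a {1..}"
    and "\<And>k. k \<ge> 1 \<Longrightarrow> distr M borel (a k) = D"
    and "j \<ge> 1"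
  shows "expectation (\<lambda>\<omega>. gilbreath (\<lambda>k. a k \<omega>) i j) = (\<integral>x. gilbreath x i 1 \<partial>(PiM {1..} (\<lambda>_. D)))"
proof -
  have rv: "a k \<in> borel_measurable M" if "k \<in> {1..}" for k
    using assms(1) that unfolding indep_vars_def2 by auto
  let ?P = "PiM {1..} (\<lambda>_::nat. D)"
  interpret D: prob_space D
    using prob_space_distr[OF rv, of 1] assms(2)[of 1] by simp
  have sets_D [measurable_cong]: "sets D = sets borel"
    using assms(2)[of 1] by (metis order_refl sets_distr)
  have sets_P: "sets ?P = sets (PiM {1..} (\<lambda>_. borel))"
    by (intro sets_PiM_cong sets_D) simp
  have law: "distr M (PiM {1..} (\<lambda>_. borel)) (\<lambda>\<omega>. \<lambda>k\<in>{1..}. a k \<omega>) = ?P"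
  proof -
    have "distr M (PiM {1..} (\<lambda>_. borel)) (\<lambda>\<omega>. \<lambda>k\<in>{1..}. a k \<omega>) = PiM {1..} (\<lambda>k. distr M borel (a k))"
      using assms(1) indep_vars_iff_distr_eq_PiM'[where M'="\<lambda>_. borel" and X=a and I="{1..}"] rv
      by simp
    also have "\<dots> = ?P"
      by (intro PiM_cong refl assms(2)) simp
    finally show ?thesis .
  qed
  have meas: "(\<lambda>x. gilbreath x i j) \<in> borel_measurable (PiM {1..} (\<lambda>_. borel))" if "j \<ge> 1" for j
    using that by (intro measurable_gilbreath) auto
  have X: "(\<lambda>\<omega>. \<lambda>k\<in>{1..}. a k \<omega>) \<in> M \<rightarrow>\<^sub>M PiM {1..} (\<lambda>_. borel)"
    by (intro measurable_restrict rv)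
  let ?S = "\<lambda>x. \<lambda>k\<in>{1..}. x (k + (j - 1)) :: real"
  have S: "?S \<in> ?P \<rightarrow>\<^sub>M ?P"
    by (intro measurable_restrict measurable_component_singleton) auto
  have shift: "distr ?P ?P ?S = ?P"
    using distr_PiM_reindex[of "{1..}" "\<lambda>_. D" "\<lambda>k. k + (j - 1)" "{1..}"] D.prob_space_axioms
    by (auto simp: inj_on_def o_def)
  have "expectation (\<lambda>\<omega>. gilbreath (\<lambda>k. a k \<omega>) i j)
      = expectation (\<lambda>\<omega>. gilbreath (\<lambda>k\<in>{1..}. a k \<omega>) i j)"
    using assms(3) by (intro Bochner_Integration.integral_cong refl gilbreath_cong_tail) auto
  also have "\<dots> = (\<integral>x. gilbreath x i j \<partial>?P)"
    using integral_distr[OF X meas[OF assms(3)]] law by simp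
  also have "\<dots> = (\<integral>x. gilbreath (?S x) i 1 \<partial>?P)"
  proof (intro Bochner_Integration.integral_cong refl)
    fix x :: "nat \<Rightarrow> real"
    have "gilbreath (?S x) i 1 = gilbreath (\<lambda>k. x (k + (j - 1))) i 1"
      by (intro gilbreath_cong_tail) auto
    also have "\<dots> = gilbreath x i j"
      using assms(3) by (subst gilbreath_shift) simp
    finally show "gilbreath x i j = gilbreath (?S x) i 1" ..
  qed
  also have "\<dots> = (\<integral>x. gilbreath x i 1 \<partial>?P)"
    using integral_distr[OF S, of "\<lambda>x. gilbreath x i 1"] meas[of 1] shift
    by (simp add: measurable_cong_sets[OF sets_P refl])
  finally show ?thesis .
qed

text \<open>By lack of memory the excess over \<open>s\<close> is, with probability \<open>exp (- s)\<close>, again a standard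
  exponential variable of mean \<open>1\<close>, and otherwise \<open>0\<close>.\<close>

lemma (in prob_space) expectation_excess_exponential:
  assumes D: "distributed M lborel X (exponential_density 1)" and s: "0 \<le> s"
  shows "expectation (\<lambda>\<omega>. max 0 (X \<omega> - s)) = exp (- s)"
proof -
  have "expectation (\<lambda>\<omega>. max 0 (X \<omega> - s)) = (\<integral>x. exponential_density 1 x * max 0 (x - s) \<partial>lborel)"
    by (rule distributed_integral[OF D, symmetric]) (auto simp: exponential_density_nonneg)
  also have "\<dots> = (\<integral>x. exponential_density 1 (s + x) * max 0 x \<partial>lborel)"
    by (subst lborel_integral_real_affine[where c=1 and t=s]) auto
  also have "\<dots> = (\<integral>x. exp (- s) * (exponential_density 1 x * x) \<partial>lborel)"
    using s by (intro Bochner_Integration.integral_cong refl)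
      (auto simp: exponential_density_def exp_add[symmetric] exp_diff exp_minus field_simps)
  also have "\<dots> = exp (- s) * expectation X"
    using distributed_integral[OF D, of "\<lambda>x. x"] by (simp add: exponential_density_nonneg)
  also have "\<dots> = exp (- s)"
    using exponential_distributed_expectation[OF _ D] by simp
  finally show ?thesis .
qed

text \<open>This is Jensen's inequality in \<open>Y\<close> with \<open>X\<close> held fixed. With \<open>s\<close> the mean of \<open>Y\<close>, a
  supporting line at \<open>y = s\<close> of the convex function \<open>y \<mapsto> max 0 (x - y)\<close> has slope \<open>- h x\<close>, where \<open>h\<close> is
  the indicator of \<open>x > s\<close>. Its linear term \<open>h X * (Y - s)\<close> has mean \<open>0\<close> by independence.\<close>

lemma (in prob_space) expectation_max_zero_diff_ge:
  fixes X Y :: "'a \<Rightarrow> real"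
  assumes ind: "indep_var borel X borel Y"
    and X: "integrable M X" and Y: "integrable M Y"
  shows "expectation (\<lambda>\<omega>. max 0 (X \<omega> - expectation Y)) \<le> expectation (\<lambda>\<omega>. max 0 (X \<omega> - Y \<omega>))"
proof -
  define s where "s = expectation Y"
  define h :: "real \<Rightarrow> real" where "h = indicator {s<..}"
  have [measurable]: "X \<in> borel_measurable M" "Y \<in> borel_measurable M" "h \<in> borel_measurable borel"
    using X Y by (auto simp: h_def)
  have hX: "integrable M (\<lambda>\<omega>. h (X \<omega>))"
    by (rule integrable_const_bound[where B=1]) (auto simp: h_def indicator_def)
  have Ys: "integrable M (\<lambda>\<omega>. Y \<omega> - s)"
    using Y by simp
  have ind': "indep_var borel (\<lambda>\<omega>. h (X \<omega>)) borel (\<lambda>\<omega>. Y \<omega> - s)"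
    using indep_var_compose[OF ind, of h borel "\<lambda>y. y - s" borel] by (simp add: o_def)
  have int0: "integrable M (\<lambda>\<omega>. h (X \<omega>) * (Y \<omega> - s))"
    by (rule indep_var_integrable[OF ind' hX Ys])
  have "expectation (\<lambda>\<omega>. h (X \<omega>) * (Y \<omega> - s)) = expectation (\<lambda>\<omega>. h (X \<omega>)) * expectation (\<lambda>\<omega>. Y \<omega> - s)"
    by (rule indep_var_lebesgue_integral[OF ind' hX Ys])
  also have "expectation (\<lambda>\<omega>. Y \<omega> - s) = 0"
    using Y by (simp add: s_def prob_space)
  finally have zero: "expectation (\<lambda>\<omega>. h (X \<omega>) * (Y \<omega> - s)) = 0" by simp
  have "expectation (\<lambda>\<omega>. max 0 (X \<omega> - s)) = expectation (\<lambda>\<omega>. max 0 (X \<omega> - s) - h (X \<omega>) * (Y \<omega> - s))"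
    using X int0 zero by (subst Bochner_Integration.integral_diff) auto
  also have "\<dots> \<le> expectation (\<lambda>\<omega>. max 0 (X \<omega> - Y \<omega>))"
    using X Y int0 by (intro integral_mono) (auto simp: h_def indicator_def)
  finally show ?thesis by (simp add: s_def)
qed

lemma ln_add_exp_1_le_of_increment:
  fixes S :: "nat \<Rightarrow> real"
  assumes "1 \<le> S 0" and "\<And>n. S n + exp (- S n) \<le> S (Suc n)"
  shows "ln (real n + exp 1) \<le> S n"
proof -
  have "real n + exp 1 \<le> exp (S n)"
  proof (induction n)
    case 0
    then show ?case using assms(1) by simp
  next
    case (Suc n)
    have "exp (S n) + 1 = exp (S n) * (1 + exp (- S n))"
      by (simp add: exp_minus field_simps)
    also have "\<dots> \<le> exp (S n) * exp (exp (- S n))"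
      by (intro mult_left_mono exp_ge_add_one_self) simp
    also have "\<dots> \<le> exp (S (Suc n))"
      using assms(2)[of n] by (simp flip: exp_add)
    finally show ?case using Suc by simp
  qed
  moreover have "0 < real n + exp 1"
    by (simp add: add_nonneg_pos)
  ultimately show ?thesis by (metis ln_exp ln_le_cancel_iff exp_gt_zero)
qed

theorem theorem1p4:
  fixes M :: "'w measure" and a :: "nat \<Rightarrow> 'w \<Rightarrow> real"
  assumes "prob_space M"
    and "prob_space.indep_vars M (\<lambda>_. borel) a {1..}"
    and "\<And>n. n \<ge> 1 \<Longrightarrow> distributed M lborel (a n) (exponential_density 1)"
  shows "\<exists>c :: nat \<Rightarrow> real.
    (\<forall>i. \<forall>j\<ge>1. integrable M (\<lambda>\<omega>. gilbreath (\<lambda>k. a k \<omega>) i j) \<and>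
                prob_space.expectation M (\<lambda>\<omega>. gilbreath (\<lambda>k. a k \<omega>) i j) = c i) \<and>
    (\<forall>n. (\<Sum>i=0..n. c i) \<ge> ln (real n + exp 1))"
proof -
  interpret prob_space M by fact
  note ind = assms(2) and expo = assms(3)
  let ?D = "density lborel (exponential_density 1)"
  let ?g = "\<lambda>i j \<omega>. gilbreath (\<lambda>k. a k \<omega>) i j"
  define c where "c i = (\<integral>x. gilbreath x i 1 \<partial>(PiM {1..} (\<lambda>_. ?D)))" for i
  have int_a: "integrable M (a k)" if "k \<ge> 1" for k
    using erlang_ith_moment_integrable[OF _ expo[OF that], of 1] by simp
  have int: "integrable M (?g i j)" if "j \<ge> 1" for i j
    using that by (intro integrable_gilbreath int_a) simp
  have "distr M borel (a k) = ?D" if "k \<ge> 1" for k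
    using distributed_distr_eq_density[OF expo[OF that]] by (metis distr_cong sets_lborel)
  then have mean: "expectation (?g i j) = c i" if "j \<ge> 1" for i j
    unfolding c_def using that by (intro expectation_gilbreath_iid ind)
  define S where "S n = (\<Sum>i<Suc n. c i)" for n
  have c0: "c 0 = 1"
    using mean[of 1 0] exponential_distributed_expectation[OF _ expo[of 1]] by simp
  have c_nonneg: "0 \<le> c i" for i
  proof (cases "i = 0")
    case False
    then show ?thesis
      using mean[of 1 i] gilbreath_nonneg[of i] by (metis Bochner_Integration.integral_nonneg neq0_conv order_refl)
  qed (simp add: c0)
  have "S n + exp (- S n) \<le> S (Suc n)" for n
  proof -
    define B where "B \<omega> = (\<Sum>i<Suc n. ?g i 2 \<omega>)" for \<omega>
    have int_B: "integrable M B"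
      unfolding B_def by (intro Bochner_Integration.integrable_sum int) simp
    have EB: "expectation B = S n"
      unfolding B_def S_def by (simp add: int mean del: sum.lessThan_Suc)
    let ?R = "\<lambda>I \<omega>. restrict (\<lambda>k. a k \<omega>) I"
    have "indep_var (PiM {1} (\<lambda>_. borel)) (?R {1}) (PiM {2..} (\<lambda>_. borel)) (?R {2..})"
      by (rule indep_var_restrict[OF ind]) auto
    moreover have "(\<lambda>x. \<Sum>i<Suc n. gilbreath x i 2) \<in> borel_measurable (PiM {2..} (\<lambda>_. borel))"
      by (intro borel_measurable_sum measurable_gilbreath) simp
    ultimately have "indep_var borel ((\<lambda>x. x 1) \<circ> ?R {1}) borel ((\<lambda>x. \<Sum>i<Suc n. gilbreath x i 2) \<circ> ?R {2..})"
      by (intro indep_var_compose) auto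
    moreover have "(\<lambda>x. \<Sum>i<Suc n. gilbreath x i 2) \<circ> ?R {2..} = B"
      unfolding B_def o_def by (intro ext sum.cong refl gilbreath_cong_tail) simp
    ultimately have ind_B: "indep_var borel (a 1) borel B"
      by (simp add: o_def)
    have "exp (- S n) = expectation (\<lambda>\<omega>. max 0 (a 1 \<omega> - expectation B))"
      unfolding EB using c_nonneg
      by (subst expectation_excess_exponential[OF expo]) (simp_all add: S_def sum_nonneg del: sum.lessThan_Suc)
    also have "\<dots> \<le> expectation (\<lambda>\<omega>. max 0 (a 1 \<omega> - B \<omega>))"
      by (intro expectation_max_zero_diff_ge ind_B int_a int_B) simp
    also have "\<dots> \<le> expectation (?g (Suc n) 1)"
    proof (intro integral_mono)
      show "integrable M (\<lambda>\<omega>. max 0 (a 1 \<omega> - B \<omega>))"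
        using int_a[of 1] int_B by simp
      show "max 0 (a 1 \<omega> - B \<omega>) \<le> ?g (Suc n) 1 \<omega>" for \<omega>
        using gilbreath_ge_first_minus_next_column[of "\<lambda>k. a k \<omega>" 1 "Suc n"]
          gilbreath_nonneg[of "Suc n"] unfolding B_def one_add_one by simp
    qed (rule int, simp)
    also have "\<dots> = c (Suc n)" by (simp only: mean order_refl)
    finally show ?thesis by (simp add: S_def)
  qed
  moreover have "1 \<le> S 0" by (simp add: S_def c0)
  ultimately have "ln (real n + exp 1) \<le> S n" for n
    by (rule ln_add_exp_1_le_of_increment[rotated])
  moreover have "S n = (\<Sum>i=0..n. c i)" for n
    unfolding S_def by (simp only: lessThan_Suc_atMost atLeast0AtMost)
  ultimately show ?thesis
    using int mean by (intro exI[of _ c]) auto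
qed

end
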